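(* Let $(X,d,\mu)$ be a metric measure space, $1<p<\infty$ and $1\le q<\infty$. If $X$ supports a semilocal $(q,p)$-Poincaré inequality, then so does its completion $\widehat X$.
   Context: $X=(X,d,\mu)$ is a metric space with a positive complete Borel measure $\mu$ such that $0<\mu(B)<\infty$ for all balls $B$. Balls are open; a ball $B$ comes with a predetermined centre and radius $r_B$, and $\lambda B$ is the concentric ball with radius $\lambda r_B$. Write $u_B=\frac1{\mu(B)}\int_B u\,d\mu$. $\widehat X$ is the completion of $X$ with respect to $d$. A set $E\subset\widehat X$ is measurable iff $E\cap X$ is $\mu$-measurable, and $\mu$ is extended by $\mu(E)=\mu(E\cap X)$, so $\mu(\widehat X\setminus X)=0$. Upper gradients: curves are nonconstant, compact and rectifiable, parameterized by arc length. A Borel function $g:X\to[0,\infty]$ is an upper gradient of $f:X\to[-\infty,\infty]$ if $|f(\gamma(0))-f(\gamma(l_\gamma))|\le\int_\gamma g\,ds$ for all curves $\gamma:[0,l_\gamma]\to X$ (left-hand side $=\infty$ if at least one term is infinite). The $(q,p)$-Poincaré inequality holds within $B(x_0,r_0)$ if there are constants $C>0$ and $\lambda\ge1$ (depending on $x_0$ and $r_0$) such that for all balls $B\subset B(x_0,r_0)$, all integrable functions $u$ on $\lambda B$ and all upper gradients $g$ of $u$, $\bigl(\frac1{\mu(B)}\int_B|u-u_B|^q\,d\mu\bigr)^{1/q}\le Cr_B\bigl(\frac1{\mu(\lambda B)}\int_{\lambda B}g^p\,d\mu\bigr)^{1/p}$. A space supports a semilocal $(q,p)$-Poincaré inequality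 if this holds within every ball of that space. *)

theory Defs
  imports "HOL-Analysis.Analysis"
begin

section \<open>Metric measure spaces and completions\<close>

text \<open>
  The metric space \<open>X\<close> is a type of class \<open>metric_space\<close>. The measure is complete and its
  \<open>\<sigma>\<close>-algebra contains, but need not equal, the Borel \<open>\<sigma>\<close>-algebra.
\<close>

locale metric_measure_space = complete_measure M for M :: "'a::metric_space measure" +
  assumes space_eq_UNIV: "space M = UNIV"
    and borel_subset_sets: "sets borel \<subseteq> sets M"
    and emeasure_ball_pos: "0 < r \<Longrightarrow> 0 < emeasure M (ball x r)"
    and emeasure_ball_finite: "0 < r \<Longrightarrow> emeasure M (ball x r) < \<infinity>"

text \<open>
  A completion is determined only up to isometry. It is given here by a complete space together with
  an isometric embedding \<open>\<iota>\<close> of \<open>X\<close> with dense range; \<open>E \<inter> X\<close> is then \<open>\<iota> -` E\<close>.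
\<close>

definition completion_embedding :: "('a::metric_space \<Rightarrow> 'b::complete_space) \<Rightarrow> bool" where
  "completion_embedding \<iota> \<longleftrightarrow>
     (\<forall>x y. dist (\<iota> x) (\<iota> y) = dist x y) \<and> closure (range \<iota>) = UNIV"

definition completion_measure :: "('a \<Rightarrow> 'b) \<Rightarrow> 'a measure \<Rightarrow> 'b measure" where
  "completion_measure \<iota> M =
     measure_of UNIV {E. \<iota> -` E \<in> sets M} (\<lambda>E. emeasure M (\<iota> -` E))"

lemma sigma_algebra_completion:
  assumes "space M = UNIV"
  shows "sigma_algebra UNIV {E. \<iota> -` E \<in> sets M}"
proof (unfold sigma_algebra_iff2, intro conjI ballI allI impI)
  show "{E. \<iota> -` E \<in> sets M} \<subseteq> Pow UNIV" "{} \<in> {E. \<iota> -` E \<in> sets M}" by auto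
next
  fix E assume "E \<in> {E. \<iota> -` E \<in> sets M}"
  then have "space M - \<iota> -` E \<in> sets M" by auto
  then show "UNIV - E \<in> {E. \<iota> -` E \<in> sets M}" by (simp add: assms vimage_Diff)
next
  fix A :: "nat \<Rightarrow> _" assume "range A \<subseteq> {E. \<iota> -` E \<in> sets M}"
  then show "(\<Union>i. A i) \<in> {E. \<iota> -` E \<in> sets M}"
    by (auto simp: vimage_UN intro!: sets.countable_UN)
qed

lemma sets_completion_measure:
  assumes "space M = UNIV"
  shows "sets (completion_measure \<iota> M) = {E. \<iota> -` E \<in> sets M}"
  unfolding completion_measure_def
  by (simp add: sigma_algebra.sets_measure_of_eq[OF sigma_algebra_completion[OF assms]])

lemma emeasure_completion_measure:
  assumes "space M = UNIV" and "\<iota> -` E \<in> sets M"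
  shows "emeasure (completion_measure \<iota> M) E = emeasure M (\<iota> -` E)"
proof (rule emeasure_measure_of[OF completion_measure_def])
  show "positive (sets (completion_measure \<iota> M)) (\<lambda>E. emeasure M (\<iota> -` E))"
    by (simp add: positive_def)
  show "countably_additive (sets (completion_measure \<iota> M)) (\<lambda>E. emeasure M (\<iota> -` E))"
    unfolding countably_additive_def sets_completion_measure[OF assms(1)]
  proof (intro allI impI)
    fix A :: "nat \<Rightarrow> _"
    assume A: "range A \<subseteq> {E. \<iota> -` E \<in> sets M}" "disjoint_family A"
    have "(\<Sum>i. emeasure M (\<iota> -` A i)) = emeasure M (\<Union>i. \<iota> -` A i)"
      using A by (intro suminf_emeasure) (auto simp: disjoint_family_on_def)
    then show "(\<Sum>i. emeasure M (\<iota> -` A i)) = emeasure M (\<iota> -` (\<Union>i. A i))"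
      by (simp add: vimage_UN)
  qed
qed (use assms in \<open>auto simp: sets_completion_measure\<close>)

section \<open>Curves and upper gradients\<close>

definition curve_length :: "(real \<Rightarrow> 'a::metric_space) \<Rightarrow> real \<Rightarrow> real \<Rightarrow> ennreal" where
  "curve_length \<gamma> a b =
     (SUP ts \<in> {ts. sorted ts \<and> set ts \<subseteq> {a..b}}.
        \<Sum>i<length ts - 1. ennreal (dist (\<gamma> (ts ! i)) (\<gamma> (ts ! Suc i))))"

text \<open>
  A compact rectifiable curve \<open>\<gamma>: [0,l] \<rightarrow> X\<close> of length \<open>l\<close>, parameterized by arc length;
  it is nonconstant iff \<open>0 < l\<close>.
\<close>

definition arc_length_curve :: "(real \<Rightarrow> 'a::metric_space) \<Rightarrow> real \<Rightarrow> bool" where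
  "arc_length_curve \<gamma> l \<longleftrightarrow> 0 < l \<and> continuous_on {0..l} \<gamma> \<and>
     (\<forall>s t. 0 \<le> s \<and> s \<le> t \<and> t \<le> l \<longrightarrow> curve_length \<gamma> s t = ennreal (t - s))"

text \<open>
  \<open>g\<close> is an upper gradient of \<open>f\<close>, where both are functions on the metric space \<open>A\<close>: only the
  values on \<open>A\<close> and the curves within \<open>A\<close> matter.
\<close>

definition upper_gradient_on ::
    "'a::metric_space set \<Rightarrow> ('a \<Rightarrow> ereal) \<Rightarrow> ('a \<Rightarrow> ennreal) \<Rightarrow> bool" where
  "upper_gradient_on A f g \<longleftrightarrow> g \<in> borel_measurable (restrict_space borel A) \<and>
     (\<forall>\<gamma> l. arc_length_curve \<gamma> l \<and> \<gamma> ` {0..l} \<subseteq> A \<longrightarrow>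
        (if \<bar>f (\<gamma> 0)\<bar> = \<infinity> \<or> \<bar>f (\<gamma> l)\<bar> = \<infinity> then \<infinity> else e2ennreal \<bar>f (\<gamma> 0) - f (\<gamma> l)\<bar>)
          \<le> (\<integral>\<^sup>+ t\<in>{0..l}. g (\<gamma> t) \<partial>lborel))"

section \<open>Poincare inequalities\<close>

text \<open>Only used with a positive exponent, so that \<open>\<infinity>\<close> has power \<open>\<infinity>\<close> and \<open>0\<close> has power \<open>0\<close>.\<close>

definition ennreal_powr :: "ennreal \<Rightarrow> real \<Rightarrow> ennreal" where
  "ennreal_powr x a = (if x = \<infinity> then \<infinity> else ennreal (enn2real x powr a))"

definition integrable_ereal_on :: "'a measure \<Rightarrow> 'a set \<Rightarrow> ('a \<Rightarrow> ereal) \<Rightarrow> bool" where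
  "integrable_ereal_on M A u \<longleftrightarrow> u \<in> borel_measurable (restrict_space M A) \<and>
     (\<integral>\<^sup>+ x\<in>A. e2ennreal \<bar>u x\<bar> \<partial>M) < \<infinity>"

text \<open>
  For integrable \<open>u\<close> the values \<open>\<plusminus>\<infinity>\<close>, which \<open>real_of_ereal\<close> sends to \<open>0\<close>, are only taken on a
  null set.
\<close>

definition integral_average :: "'a measure \<Rightarrow> 'a set \<Rightarrow> ('a \<Rightarrow> ereal) \<Rightarrow> real" where
  "integral_average M B u = (1 / measure M B) * (LINT x:B|M. real_of_ereal (u x))"

definition nn_average :: "'a measure \<Rightarrow> 'a set \<Rightarrow> ('a \<Rightarrow> ennreal) \<Rightarrow> ennreal" where
  "nn_average M B h = (\<integral>\<^sup>+ x\<in>B. h x \<partial>M) / emeasure M B"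

text \<open>
  A ball is given by its centre and radius; \<open>C\<close> and \<open>lam\<close> depend only on \<open>x\<^sub>0\<close> and \<open>r\<^sub>0\<close>.
  The functions \<open>u\<close> and \<open>g\<close> live on \<open>lam B\<close>, i.e. \<open>g\<close> is an upper gradient of \<open>u\<close> in \<open>lam B\<close>.
\<close>

definition poincare_within ::
    "'a::metric_space measure \<Rightarrow> real \<Rightarrow> real \<Rightarrow> 'a \<Rightarrow> real \<Rightarrow> bool" where
  "poincare_within M q p x\<^sub>0 r\<^sub>0 \<longleftrightarrow>
     (\<exists>C lam::real. 0 < C \<and> 1 \<le> lam \<and>
       (\<forall>x r. 0 < r \<and> ball x r \<subseteq> ball x\<^sub>0 r\<^sub>0 \<longrightarrow>
         (\<forall>u g. integrable_ereal_on M (ball x (lam * r)) u \<and>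
                 upper_gradient_on (ball x (lam * r)) u g \<longrightarrow>
            ennreal_powr
              (nn_average M (ball x r)
                (\<lambda>y. ennreal_powr
                       (e2ennreal \<bar>u y - ereal (integral_average M (ball x r) u)\<bar>) q))
              (1 / q)
            \<le> ennreal (C * r) *
              ennreal_powr (nn_average M (ball x (lam * r)) (\<lambda>y. ennreal_powr (g y) p)) (1 / p))))"

definition semilocal_poincare :: "'a::metric_space measure \<Rightarrow> real \<Rightarrow> real \<Rightarrow> bool" where
  "semilocal_poincare M q p \<longleftrightarrow> (\<forall>x\<^sub>0 r\<^sub>0. 0 < r\<^sub>0 \<longrightarrow> poincare_within M q p x\<^sub>0 r\<^sub>0)"

end

theory Submission
  imports Defs
begin

text \<open>
  A ball \<open>B\<close> of the completion, intersected with \<open>X\<close>, is exhausted from inside by balls \<open>B\<^sub>n\<close> of \<open>X\<close>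
  whose centres converge to the centre of \<open>B\<close> and whose radii increase to that of \<open>B\<close>. Since
  \<open>\<lambda> \<ge> 1\<close>, also \<open>\<lambda>B\<^sub>n \<subseteq> \<lambda>B\<close>, and these balls exhaust \<open>\<lambda>B \<inter> X\<close>. Upper gradients in the completion
  restrict to upper gradients in \<open>X\<close>, and the Poincare inequalities on the \<open>B\<^sub>n\<close>, which hold with
  the same constants, pass to the limit by Fatou's lemma and dominated convergence.
\<close>

section \<open>Powers of extended nonnegative reals\<close>

lemma ennreal_powr_mono:
  assumes "0 < a" "x \<le> y"
  shows "ennreal_powr x a \<le> ennreal_powr y a"
proof (cases "y = \<infinity>")
  case False
  then have "y < top" by (simp add: less_top)
  then have "x < top" using assms(2) by (rule le_less_trans[rotated])
  then show ?thesis
    using assms \<open>y < top\<close>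
    by (simp add: ennreal_powr_def less_top[symmetric] ennreal_leI powr_mono2 enn2real_mono)
qed (simp add: ennreal_powr_def)

text \<open>The conventions at 0 and \<infinity> make the power map with a positive exponent
  invertible on all of \<open>ennreal\<close>. Used with \<open>q\<close> and with
  \<open>1 / q\<close>, it removes the outer root of an oscillation and later restores it.\<close>

lemma ennreal_powr_inverse:
  assumes "0 < a"
  shows "ennreal_powr (ennreal_powr x (1 / a)) a = x"
proof (cases x)
  case (real r)
  then show ?thesis
    using assms by (cases "r = 0") (auto simp: ennreal_powr_def powr_powr)
qed (simp add: ennreal_powr_def)

text \<open>A monotone map with open range is continuous for the order topologies. Here the range is
  the whole space, since the inverse power supplies preimages; the point \<infinity> thus needs no
  separate argument.\<close>

lemma continuous_on_ennreal_powr: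
  assumes "0 < a"
  shows "continuous_on UNIV (\<lambda>x. ennreal_powr x a)"
proof (rule continuous_onI_mono)
  have "surj (\<lambda>x. ennreal_powr x a)"
    using ennreal_powr_inverse[OF assms] by (metis surjI)
  then show "open (range (\<lambda>x. ennreal_powr x a))" by simp
qed (simp add: ennreal_powr_mono assms)

lemma tendsto_ennreal_powr:
  assumes "0 < a" "(f \<longlongrightarrow> l) F"
  shows "((\<lambda>x. ennreal_powr (f x) a) \<longlongrightarrow> ennreal_powr l a) F"
  using continuous_on_tendsto_compose[OF continuous_on_ennreal_powr[OF assms(1)] assms(2)] by simp

lemma inverse_ennreal_antimono:
  fixes x y :: ennreal
  assumes "x \<le> y"
  shows "inverse y \<le> inverse x"
  using assms by (simp add: less_eq_ennreal.rep_eq inverse_ennreal.rep_eq ereal_inverse_antimono)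

text \<open>For finite \<open>b\<close> this is continuity of the inverse, which sends 0 to
  \<infinity>. If \<open>b\<close> is infinite, all quotients are infinite because the denominators
  and their limit are finite; this case occurs when the gradient is not p-integrable.\<close>

lemma tendsto_divide_ennreal_const:
  fixes b l :: ennreal
  assumes "(f \<longlongrightarrow> l) F" "l \<noteq> top" "\<And>x. f x \<noteq> top"
  shows "((\<lambda>x. b / f x) \<longlongrightarrow> b / l) F"
proof (cases "b = top")
  case True
  then show ?thesis using assms(2,3) by (simp add: ennreal_top_divide)
next
  case False
  have "continuous_on UNIV (inverse :: ennreal \<Rightarrow> ennreal)"
    by (intro continuous_on_inverse_ennreal continuous_on_id)
  then have "((\<lambda>x. inverse (f x)) \<longlongrightarrow> inverse l) F"
    using assms(1) by (rule continuous_on_tendsto_compose) auto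
  then show ?thesis
    unfolding divide_ennreal_def using False by (intro ennreal_tendsto_cmult) (simp_all add: less_top)
qed

lemma borel_measurable_ennreal_powr:
  assumes "0 < a" "f \<in> borel_measurable M"
  shows "(\<lambda>x. ennreal_powr (f x) a) \<in> borel_measurable M"
  using measurable_compose[OF assms(2) borel_measurable_continuous_onI[OF continuous_on_ennreal_powr[OF assms(1)]]]
  by simp

text \<open>For infinite \<open>x\<close> both sides are constantly \<infinity>, because
  \<open>c n\<close> and \<open>l\<close> are real. Convergence therefore holds at every point, also
  where an integrable function is infinite.\<close>

lemma tendsto_abs_ereal_diff:
  assumes "c \<longlonglongrightarrow> l"
  shows "(\<lambda>n. e2ennreal \<bar>x - ereal (c n)\<bar>) \<longlonglongrightarrow> e2ennreal \<bar>x - ereal l\<bar>"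
proof (cases x)
  case (real r)
  have "(\<lambda>n. ennreal \<bar>r - c n\<bar>) \<longlonglongrightarrow> ennreal \<bar>r - l\<bar>"
    by (intro tendsto_ennrealI tendsto_intros assms)
  then show ?thesis using real by (simp add: ennreal.abs_eq[symmetric] e2ennreal_ereal)
qed auto

section \<open>Exhaustion of the sets in a Poincare inequality\<close>

lemma tendsto_set_integral_exhaustion:
  fixes f :: "'a \<Rightarrow> real"
  assumes f: "set_integrable M A f"
    and sets: "\<And>n. B n \<in> sets M" "\<And>n. B n \<subseteq> A"
    and ev: "\<And>y. y \<in> A \<Longrightarrow> eventually (\<lambda>n. y \<in> B n) sequentially"
  shows "(\<lambda>n. LINT x:B n|M. f x) \<longlonglongrightarrow> (LINT x:A|M. f x)"
  unfolding set_lebesgue_integral_def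
proof (rule integral_dominated_convergence)
  have "set_integrable M (B n) f" for n
    using f sets by (rule set_integrable_subset)
  then show "(\<lambda>x. indicator (B n) x *\<^sub>R f x) \<in> borel_measurable M" for n
    unfolding set_integrable_def by (rule borel_measurable_integrable)
  show "(\<lambda>x. indicator A x *\<^sub>R f x) \<in> borel_measurable M"
    using f unfolding set_integrable_def by (rule borel_measurable_integrable)
  show "integrable M (\<lambda>x. \<bar>indicator A x *\<^sub>R f x\<bar>)"
    using f unfolding set_integrable_def by (rule integrable_abs)
  show "AE x in M. (\<lambda>n. indicator (B n) x *\<^sub>R f x) \<longlonglongrightarrow> indicator A x *\<^sub>R f x"
  proof (rule AE_I2, rule tendsto_eventually)
    fix x
    show "eventually (\<lambda>n. indicator (B n) x *\<^sub>R f x = indicator A x *\<^sub>R f x) sequentially"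
    proof (cases "x \<in> A")
      case True
      from ev[OF this] show ?thesis by eventually_elim (use True in simp)
    next
      case False
      then have "x \<notin> B n" for n using sets(2) by auto
      with False show ?thesis by simp
    qed
  qed
  show "AE x in M. norm (indicator (B n) x *\<^sub>R f x) \<le> \<bar>indicator A x *\<^sub>R f x\<bar>" for n
    using sets(2)[of n] by (intro AE_I2) (auto simp: indicator_def)
qed

lemma tendsto_measure_exhaustion:
  assumes "A \<in> sets M" "emeasure M A < \<infinity>"
    and "\<And>n. B n \<in> sets M" "\<And>n. B n \<subseteq> A"
    and "\<And>y. y \<in> A \<Longrightarrow> eventually (\<lambda>n. y \<in> B n) sequentially"
  shows "(\<lambda>n. measure M (B n)) \<longlonglongrightarrow> measure M A"
proof -
  have "set_integrable M A (\<lambda>x. 1::real)"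
    using assms(1,2) by (simp add: set_integrable_def)
  from tendsto_set_integral_exhaustion[OF this assms(3-5)] show ?thesis
    using assms(1,3) by (simp add: set_lebesgue_integral_def)
qed

lemma set_integrable_real_of_ereal:
  assumes "integrable_ereal_on M A u" "A \<in> sets M"
  shows "set_integrable M A (\<lambda>x. real_of_ereal (u x))"
  unfolding set_integrable_def
proof (rule integrableI_bounded)
  have "u \<in> borel_measurable (restrict_space M A)"
    using assms(1) by (simp add: integrable_ereal_on_def)
  then have "(\<lambda>x. real_of_ereal (u x)) \<in> borel_measurable (restrict_space M A)"
    by measurable
  then show "(\<lambda>x. indicator A x *\<^sub>R real_of_ereal (u x)) \<in> borel_measurable M"
    using assms(2) by (subst (asm) borel_measurable_restrict_space_iff) simp_all
  \<comment> \<open>For infinite \<open>z\<close> the left-hand side is 0 by the convention for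
    \<open>real_of_ereal\<close>.\<close>
  have le: "ennreal (real_of_ereal \<bar>z\<bar>) \<le> e2ennreal \<bar>z\<bar>" for z
    by (cases z) (auto simp: ennreal.abs_eq[symmetric] e2ennreal_ereal)
  have "(\<integral>\<^sup>+ x. ennreal (norm (indicator A x *\<^sub>R real_of_ereal (u x))) \<partial>M)
      \<le> (\<integral>\<^sup>+ x\<in>A. e2ennreal \<bar>u x\<bar> \<partial>M)"
    by (intro nn_integral_mono) (auto simp: indicator_def le)
  also have "\<dots> < \<infinity>" using assms(1) by (simp add: integrable_ereal_on_def)
  finally show "(\<integral>\<^sup>+ x. ennreal (norm (indicator A x *\<^sub>R real_of_ereal (u x))) \<partial>M) < \<infinity>" .
qed

lemma integrable_ereal_on_subset:
  assumes "integrable_ereal_on M A u" "B \<subseteq> A"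
  shows "integrable_ereal_on M B u"
  unfolding integrable_ereal_on_def
proof
  show "u \<in> borel_measurable (restrict_space M B)"
    using assms measurable_restrict_mono by (auto simp: integrable_ereal_on_def)
  have "(\<integral>\<^sup>+ x\<in>B. e2ennreal \<bar>u x\<bar> \<partial>M) \<le> (\<integral>\<^sup>+ x\<in>A. e2ennreal \<bar>u x\<bar> \<partial>M)"
    using assms(2) by (intro nn_integral_mono) (auto simp: indicator_def)
  also have "\<dots> < \<infinity>" using assms(1) by (simp add: integrable_ereal_on_def)
  finally show "(\<integral>\<^sup>+ x\<in>B. e2ennreal \<bar>u x\<bar> \<partial>M) < \<infinity>" .
qed

section \<open>The two sides of the Poincare inequality and their behaviour under exhaustion\<close>

definition mean_oscillation :: "'a measure \<Rightarrow> real \<Rightarrow> 'a set \<Rightarrow> ('a \<Rightarrow> ereal) \<Rightarrow> ennreal" where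
  "mean_oscillation M q B u = ennreal_powr
     (nn_average M B (\<lambda>y. ennreal_powr (e2ennreal \<bar>u y - ereal (integral_average M B u)\<bar>) q)) (1 / q)"

definition gradient_mean :: "'a measure \<Rightarrow> real \<Rightarrow> 'a set \<Rightarrow> ('a \<Rightarrow> ennreal) \<Rightarrow> ennreal" where
  "gradient_mean M p B g = ennreal_powr (nn_average M B (\<lambda>y. ennreal_powr (g y) p)) (1 / p)"

lemma poincare_within_iff:
  "poincare_within M q p x\<^sub>0 r\<^sub>0 \<longleftrightarrow>
     (\<exists>C lam::real. 0 < C \<and> 1 \<le> lam \<and>
       (\<forall>x r. 0 < r \<and> ball x r \<subseteq> ball x\<^sub>0 r\<^sub>0 \<longrightarrow>
         (\<forall>u g. integrable_ereal_on M (ball x (lam * r)) u \<and>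
                 upper_gradient_on (ball x (lam * r)) u g \<longrightarrow>
            mean_oscillation M q (ball x r) u
              \<le> ennreal (C * r) * gradient_mean M p (ball x (lam * r)) g)))"
  unfolding poincare_within_def mean_oscillation_def gradient_mean_def ..

text \<open>Since \<open>u\<close> is measurable only on \<open>A\<close>, the indicator is needed
  to extend the integrand by zero to the whole space.\<close>

lemma borel_measurable_oscillation:
  assumes "u \<in> borel_measurable (restrict_space M A)" "A \<in> sets M" "0 < q"
  shows "(\<lambda>y. ennreal_powr (e2ennreal \<bar>u y - ereal c\<bar>) q * indicator A y) \<in> borel_measurable M"
proof -
  note [measurable] = assms(1)
  have "(\<lambda>y. e2ennreal \<bar>u y - ereal c\<bar>) \<in> borel_measurable (restrict_space M A)"
    by measurable
  from borel_measurable_ennreal_powr[OF assms(3) this] show ?thesis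
    using assms(2) by (subst (asm) borel_measurable_restrict_space_iff_ennreal) simp_all
qed

text \<open>Masses and integrals converge separately; the quotient converges because the limiting
  mass is finite and nonzero.\<close>

lemma tendsto_integral_average_exhaustion:
  assumes "integrable_ereal_on M A u" "A \<in> sets M" "0 < emeasure M A" "emeasure M A < \<infinity>"
    and "\<And>n. B n \<in> sets M" "\<And>n. B n \<subseteq> A"
    and "\<And>y. y \<in> A \<Longrightarrow> eventually (\<lambda>n. y \<in> B n) sequentially"
  shows "(\<lambda>n. integral_average M (B n) u) \<longlonglongrightarrow> integral_average M A u"
proof -
  have "emeasure M A = ennreal (measure M A)"
    using assms(4) by (intro emeasure_eq_ennreal_measure) auto
  then have "measure M A \<noteq> 0" using assms(3) by auto
  then show ?thesis
    unfolding integral_average_def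
    by (intro tendsto_intros tendsto_measure_exhaustion tendsto_set_integral_exhaustion
        set_integrable_real_of_ereal assms)
qed

text \<open>Fatou's lemma. The majorant required by dominated convergence is missing, since
  \<open>u\<close> is integrable but its q-th power may not be; the inequality suffices for a bound
  from above.\<close>

lemma nn_oscillation_le_liminf:
  assumes u: "integrable_ereal_on M A u" and A: "A \<in> sets M" "0 < emeasure M A" "emeasure M A < \<infinity>"
    and B: "\<And>n. B n \<in> sets M" "\<And>n. B n \<subseteq> A"
    and ev: "\<And>y. y \<in> A \<Longrightarrow> eventually (\<lambda>n. y \<in> B n) sequentially"
    and "0 < q"
  shows "(\<integral>\<^sup>+ y\<in>A. ennreal_powr (e2ennreal \<bar>u y - ereal (integral_average M A u)\<bar>) q \<partial>M)
    \<le> liminf (\<lambda>n. \<integral>\<^sup>+ y\<in>B n. ennreal_powr (e2ennreal \<bar>u y - ereal (integral_average M (B n) u)\<bar>) q \<partial>M)"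
    (is "(\<integral>\<^sup>+ y. ?f y * _ \<partial>M) \<le> liminf (\<lambda>n. \<integral>\<^sup>+ y. ?f' n y * _ \<partial>M)")
proof -
  \<comment> \<open>Two effects combine: the averages subtracted from \<open>u\<close> converge, and
    each point of \<open>A\<close> eventually lies in \<open>B n\<close>.\<close>
  have lim: "(\<lambda>n. ?f' n y * indicator (B n) y) \<longlonglongrightarrow> ?f y * indicator A y" for y
  proof (cases "y \<in> A")
    case True
    have "(\<lambda>n. ?f' n y) \<longlonglongrightarrow> ?f y"
      using u A B ev \<open>0 < q\<close>
      by (intro tendsto_ennreal_powr tendsto_abs_ereal_diff tendsto_integral_average_exhaustion)
    moreover have "eventually (\<lambda>n. ?f' n y = ?f' n y * indicator (B n) y) sequentially"
      using ev[OF True] by eventually_elim simp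
    ultimately have "(\<lambda>n. ?f' n y * indicator (B n) y) \<longlonglongrightarrow> ?f y"
      by (rule Lim_transform_eventually)
    then show ?thesis using True by simp
  next
    case False
    then have "y \<notin> B n" for n using B(2) by auto
    then show ?thesis using False by simp
  qed
  have "(\<integral>\<^sup>+ y. ?f y * indicator A y \<partial>M) = (\<integral>\<^sup>+ y. liminf (\<lambda>n. ?f' n y * indicator (B n) y) \<partial>M)"
    by (intro nn_integral_cong lim_imp_Liminf[symmetric] trivial_limit_sequentially lim)
  also have "\<dots> \<le> liminf (\<lambda>n. \<integral>\<^sup>+ y. ?f' n y * indicator (B n) y \<partial>M)"
  proof (rule nn_integral_liminf)
    fix n
    show "(\<lambda>y. ?f' n y * indicator (B n) y) \<in> borel_measurable M"
      using integrable_ereal_on_subset[OF u B(2)] B(1) \<open>0 < q\<close>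
      by (intro borel_measurable_oscillation) (auto simp: integrable_ereal_on_def)
  qed
  finally show ?thesis .
qed

text \<open>Fatou's lemma controls the left-hand side after its q-th root has been removed. On the
  right the gradient integral over \<open>D n\<close> is simply bounded by that over
  \<open>T\<close>, so only the masses of \<open>D n\<close> have to converge.\<close>

lemma poincare_inequality_exhaustion:
  assumes S: "S \<in> sets M" "0 < emeasure M S" "\<And>n. B n \<in> sets M" "\<And>n. B n \<subseteq> S"
      "\<And>y. y \<in> S \<Longrightarrow> eventually (\<lambda>n. y \<in> B n) sequentially"
    and T: "T \<in> sets M" "emeasure M T < \<infinity>" "\<And>n. D n \<in> sets M" "\<And>n. D n \<subseteq> T"
      "\<And>y. y \<in> T \<Longrightarrow> eventually (\<lambda>n. y \<in> D n) sequentially"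
    and "S \<subseteq> T" and u: "integrable_ereal_on M T u" and pq: "0 < p" "0 < q"
    and ineq: "\<And>n. mean_oscillation M q (B n) u \<le> ennreal c * gradient_mean M p (D n) g"
  shows "mean_oscillation M q S u \<le> ennreal c * gradient_mean M p T g"
proof -
  define a where "a A = (\<integral>\<^sup>+ y\<in>A. ennreal_powr (e2ennreal \<bar>u y - ereal (integral_average M A u)\<bar>) q \<partial>M)" for A
  define b where "b = (\<integral>\<^sup>+ y\<in>T. ennreal_powr (g y) p \<partial>M)"
  \<comment> \<open>\<open>K m\<close> is the q-th power of the right-hand side, with gradient
    integral taken over \<open>T\<close> and normalising mass \<open>m\<close>. At
    \<open>m = emeasure M T\<close> it is the q-th power of the desired bound.\<close>
  define K where "K m = ennreal_powr (ennreal c * ennreal_powr (b / m) (1 / p)) q" for m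
  have ST: "emeasure M S \<le> emeasure M T" using \<open>S \<subseteq> T\<close> T(1) by (rule emeasure_mono)
  then have S_fin: "emeasure M S < \<infinity>" using T(2) by (rule le_less_trans)
  have bound: "a (B n) \<le> K (emeasure M (D n)) * emeasure M S" for n
  proof -
    have BS: "emeasure M (B n) \<le> emeasure M S" using S by (intro emeasure_mono)
    \<comment> \<open>Dividing by the larger mass of \<open>S\<close> only decreases the quotient,
      so the normalisation on the left no longer depends on \<open>n\<close>.\<close>
    have "a (B n) / emeasure M S \<le> a (B n) / emeasure M (B n)"
      unfolding divide_ennreal_def using inverse_ennreal_antimono[OF BS] by (rule mult_left_mono) simp
    also have "\<dots> = ennreal_powr (mean_oscillation M q (B n) u) q"
      using pq by (simp add: mean_oscillation_def nn_average_def a_def ennreal_powr_inverse)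
    also have "\<dots> \<le> ennreal_powr (ennreal c * gradient_mean M p (D n) g) q"
      using ineq pq by (intro ennreal_powr_mono)
    also have "\<dots> \<le> K (emeasure M (D n))"
    proof -
      have "nn_average M (D n) (\<lambda>y. ennreal_powr (g y) p) \<le> b / emeasure M (D n)"
        unfolding nn_average_def b_def using T(4)[of n]
        by (intro divide_right_mono_ennreal nn_integral_mono) (auto simp: indicator_def)
      then show ?thesis
        unfolding K_def gradient_mean_def using pq
        by (intro ennreal_powr_mono mult_left_mono) auto
    qed
    finally have "a (B n) / emeasure M S * emeasure M S \<le> K (emeasure M (D n)) * emeasure M S"
      by (rule mult_right_mono) simp
    then show ?thesis
      using S(2) S_fin by (simp add: ennreal_divide_times ennreal_divide_self)
  qed
  \<comment> \<open>Finiteness of these masses is what allows \<open>b / emeasure M (D n)\<close> to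
    converge even if \<open>b\<close> is infinite.\<close>
  have emeas_D: "emeasure M (D n) = ennreal (measure M (D n))" for n
    using emeasure_mono[OF T(4) T(1), of n] T(2)
    by (intro emeasure_eq_ennreal_measure) (auto simp: top_unique)
  have "(\<lambda>n. emeasure M (D n)) \<longlonglongrightarrow> ennreal (measure M T)"
    unfolding emeas_D using T by (intro tendsto_ennrealI tendsto_measure_exhaustion)
  then have lim_D: "(\<lambda>n. emeasure M (D n)) \<longlonglongrightarrow> emeasure M T"
    using T(2) by (simp add: emeasure_eq_ennreal_measure)
  have "(\<lambda>n. b / emeasure M (D n)) \<longlonglongrightarrow> b / emeasure M T"
    using T(2) lim_D by (intro tendsto_divide_ennreal_const) (auto simp: emeas_D)
  then have "(\<lambda>n. emeasure M S * K (emeasure M (D n))) \<longlonglongrightarrow> emeasure M S * K (emeasure M T)"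
    unfolding K_def using pq S_fin
    by (intro tendsto_ennreal_powr ennreal_tendsto_cmult) auto
  then have "(\<lambda>n. K (emeasure M (D n)) * emeasure M S) \<longlonglongrightarrow> K (emeasure M T) * emeasure M S"
    by (simp only: mult.commute)
  then have lim_K: "liminf (\<lambda>n. K (emeasure M (D n)) * emeasure M S) = K (emeasure M T) * emeasure M S"
    by (intro lim_imp_Liminf) simp_all
  have "a S \<le> liminf (\<lambda>n. a (B n))"
    unfolding a_def using S S_fin integrable_ereal_on_subset[OF u \<open>S \<subseteq> T\<close>] pq
    by (intro nn_oscillation_le_liminf)
  also have "\<dots> \<le> liminf (\<lambda>n. K (emeasure M (D n)) * emeasure M S)"
    by (intro Liminf_mono always_eventually allI bound)
  finally have "a S \<le> K (emeasure M T) * emeasure M S" unfolding lim_K .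
  \<comment> \<open>The mass of \<open>S\<close> is positive and finite, so it cancels; taking q-th
    roots then returns to the original form of the inequality.\<close>
  then have "a S / emeasure M S \<le> K (emeasure M T) * emeasure M S / emeasure M S"
    by (rule divide_right_mono_ennreal)
  also have "\<dots> = K (emeasure M T)"
    using S(2) S_fin by (simp add: ennreal_mult_divide_eq)
  finally have "ennreal_powr (a S / emeasure M S) (1 / q) \<le> ennreal_powr (K (emeasure M T)) (1 / q)"
    using pq by (intro ennreal_powr_mono) auto
  moreover have "ennreal_powr (K (emeasure M T)) (1 / q) = ennreal c * gradient_mean M p T g"
    unfolding K_def gradient_mean_def nn_average_def b_def
    using ennreal_powr_inverse[of "1 / q"] pq by simp
  ultimately show ?thesis
    unfolding mean_oscillation_def nn_average_def a_def by simp
qed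

section \<open>Passing to the completion\<close>

lemma completion_embedding_continuous:
  assumes "completion_embedding \<iota>"
  shows "continuous_on A \<iota>"
proof -
  have "dist (\<iota> x) (\<iota> y) = dist x y" for x y
    using assms by (simp add: completion_embedding_def)
  then show ?thesis unfolding continuous_on_iff by metis
qed

text \<open>An isometry preserves every polygonal sum, hence the length of each subarc and with it
  the arc length parameterization.\<close>

lemma arc_length_curve_completion:
  assumes "completion_embedding \<iota>" "arc_length_curve \<gamma> l"
  shows "arc_length_curve (\<iota> \<circ> \<gamma>) l"
proof -
  have "curve_length (\<iota> \<circ> \<gamma>) s t = curve_length \<gamma> s t" for s t
    using assms(1) by (simp add: curve_length_def completion_embedding_def)
  moreover have "continuous_on {0..l} (\<iota> \<circ> \<gamma>)"
    using assms(2) completion_embedding_continuous[OF assms(1)]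
    by (intro continuous_on_compose) (simp_all add: arc_length_curve_def)
  ultimately show ?thesis
    using assms(2) unfolding arc_length_curve_def by metis
qed

text \<open>Each curve in \<open>A\<close> becomes a curve in \<open>T\<close> with the same
  parameterization, so its inequality is an instance of the one in the completion. Borel
  measurability survives because \<iota> is continuous.\<close>

lemma upper_gradient_on_completion:
  assumes \<iota>: "completion_embedding \<iota>" and ug: "upper_gradient_on T u g" and sub: "\<iota> ` A \<subseteq> T"
  shows "upper_gradient_on A (u \<circ> \<iota>) (g \<circ> \<iota>)"
  unfolding upper_gradient_on_def
proof (intro conjI allI impI)
  have "\<iota> \<in> borel_measurable borel"
    using \<iota> by (intro borel_measurable_continuous_onI completion_embedding_continuous)
  then have "\<iota> \<in> restrict_space borel A \<rightarrow>\<^sub>M restrict_space borel T"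
    using sub by (intro measurable_restrict_space3) auto
  then show "g \<circ> \<iota> \<in> borel_measurable (restrict_space borel A)"
    using ug by (auto simp: upper_gradient_on_def)
next
  fix \<gamma> :: "real \<Rightarrow> 'a" and l
  assume "arc_length_curve \<gamma> l \<and> \<gamma> ` {0..l} \<subseteq> A"
  then have "arc_length_curve (\<iota> \<circ> \<gamma>) l" "(\<iota> \<circ> \<gamma>) ` {0..l} \<subseteq> T"
    using sub by (simp_all add: arc_length_curve_completion[OF \<iota>] image_subset_iff)
  then show "(if \<bar>(u \<circ> \<iota>) (\<gamma> 0)\<bar> = \<infinity> \<or> \<bar>(u \<circ> \<iota>) (\<gamma> l)\<bar> = \<infinity> then \<infinity>
      else e2ennreal \<bar>(u \<circ> \<iota>) (\<gamma> 0) - (u \<circ> \<iota>) (\<gamma> l)\<bar>) \<le> (\<integral>\<^sup>+ t\<in>{0..l}. (g \<circ> \<iota>) (\<gamma> t) \<partial>lborel)"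
    using conjunct2[OF ug[unfolded upper_gradient_on_def], rule_format, OF conjI, of "\<iota> \<circ> \<gamma>" l]
    by (simp only: comp_apply)
qed

section \<open>The extended measure and the pullback of its integrals to X\<close>

context
  fixes M :: "'a::metric_space measure" and \<iota> :: "'a \<Rightarrow> 'b::complete_space"
  assumes M: "metric_measure_space M" and \<iota>: "completion_embedding \<iota>"
begin

interpretation metric_measure_space M by (rule M)

abbreviation (input) "N \<equiv> completion_measure \<iota> M"

lemma dist_embedding [simp]: "dist (\<iota> x) (\<iota> y) = dist x y"
  using \<iota> by (simp add: completion_embedding_def)

lemma embedding_dense:
  assumes "0 < e"
  obtains x where "dist (\<iota> x) z < e"
proof -
  have "z \<in> closure (range \<iota>)" using \<iota> by (simp add: completion_embedding_def)
  then show ?thesis using assms that unfolding closure_approachable by auto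
qed

lemma sets_N: "sets N = {E. \<iota> -` E \<in> sets M}"
  by (rule sets_completion_measure[OF space_eq_UNIV])

lemma space_N: "space N = UNIV"
  by (simp add: completion_measure_def space_measure_of_conv)

lemma measurable_embedding: "\<iota> \<in> measurable M N"
  by (rule measurableI) (auto simp: space_N sets_N space_eq_UNIV)

lemma emeasure_N: "E \<in> sets N \<Longrightarrow> emeasure N E = emeasure M (\<iota> -` E)"
  by (rule emeasure_completion_measure[OF space_eq_UNIV]) (simp add: sets_N)

text \<open>Recognising the extended measure as an image measure makes the change of variables
  theorems available.\<close>

lemma N_eq_distr: "N = distr M N \<iota>"
  by (rule measure_eqI)
    (auto simp: emeasure_distr[OF measurable_embedding] space_eq_UNIV emeasure_N)

lemma nn_integral_N: "f \<in> borel_measurable N \<Longrightarrow> (\<integral>\<^sup>+ x. f x \<partial>N) = (\<integral>\<^sup>+ x. f (\<iota> x) \<partial>M)"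
  by (subst N_eq_distr) (simp add: nn_integral_distr[OF measurable_embedding])

lemma integral_N:
  fixes f :: "'b \<Rightarrow> real"
  shows "f \<in> borel_measurable N \<Longrightarrow> (\<integral> x. f x \<partial>N) = (\<integral> x. f (\<iota> x) \<partial>M)"
  by (subst N_eq_distr) (simp add: integral_distr[OF measurable_embedding])

lemma borel_subset_sets_N: "sets borel \<subseteq> sets N"
proof
  fix E :: "'b set" assume "E \<in> sets borel"
  moreover have "\<iota> \<in> borel_measurable borel"
    using \<iota> by (intro borel_measurable_continuous_onI completion_embedding_continuous)
  ultimately have "\<iota> -` E \<in> sets borel" by (rule measurable_sets_borel[rotated])
  then show "E \<in> sets N" using borel_subset_sets by (auto simp: sets_N)
qed

lemma ball_in_sets_N: "ball x r \<in> sets N"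
  using borel_subset_sets_N by auto

text \<open>Upper gradients are Borel, whereas their averages are integrals for the possibly larger
  \<sigma>-algebra of \<open>N\<close>.\<close>

lemma borel_measurable_restrict_N:
  assumes "g \<in> borel_measurable (restrict_space borel A)"
  shows "g \<in> borel_measurable (restrict_space N A)"
proof (rule measurableI)
  fix E :: "'c set" assume "E \<in> sets borel"
  then have "g -` E \<inter> space (restrict_space borel A) \<in> sets (restrict_space borel A)"
    using assms by (rule measurable_sets[rotated])
  then show "g -` E \<inter> space (restrict_space N A) \<in> sets (restrict_space N A)"
    using borel_subset_sets_N by (auto simp: space_restrict_space space_N sets_restrict_space)
qed simp

lemma integrable_ereal_on_N:
  assumes "integrable_ereal_on N T u" "T \<in> sets N"
  shows "integrable_ereal_on M (\<iota> -` T) (u \<circ> \<iota>)"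
  unfolding integrable_ereal_on_def
proof
  have u: "u \<in> borel_measurable (restrict_space N T)"
    using assms(1) by (simp add: integrable_ereal_on_def)
  have "\<iota> \<in> restrict_space M (\<iota> -` T) \<rightarrow>\<^sub>M restrict_space N T"
    by (intro measurable_restrict_space3 measurable_embedding) auto
  then show "u \<circ> \<iota> \<in> borel_measurable (restrict_space M (\<iota> -` T))"
    using u by (rule measurable_comp)
  have "(\<lambda>x. e2ennreal \<bar>u x\<bar>) \<in> borel_measurable (restrict_space N T)"
    using u by measurable
  then have "(\<lambda>x. e2ennreal \<bar>u x\<bar> * indicator T x) \<in> borel_measurable N"
    using assms(2) by (subst (asm) borel_measurable_restrict_space_iff_ennreal) simp_all
  then have "(\<integral>\<^sup>+ x\<in>T. e2ennreal \<bar>u x\<bar> \<partial>N) = (\<integral>\<^sup>+ x\<in>\<iota> -` T. e2ennreal \<bar>(u \<circ> \<iota>) x\<bar> \<partial>M)"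
    by (simp add: nn_integral_N indicator_def)
  then show "(\<integral>\<^sup>+ x\<in>\<iota> -` T. e2ennreal \<bar>(u \<circ> \<iota>) x\<bar> \<partial>M) < \<infinity>"
    using assms(1) by (simp add: integrable_ereal_on_def)
qed

text \<open>Change of variables is applied twice: first to the average inside the oscillation, then
  to the outer integral with this average as a fixed constant.\<close>

lemma mean_oscillation_N:
  assumes u: "integrable_ereal_on N S u" and S: "S \<in> sets N" and "0 < q"
  shows "mean_oscillation N q S u = mean_oscillation M q (\<iota> -` S) (u \<circ> \<iota>)"
proof -
  have "(\<lambda>x. indicator S x *\<^sub>R real_of_ereal (u x)) \<in> borel_measurable N"
    using set_integrable_real_of_ereal[OF u S] unfolding set_integrable_def
    by (rule borel_measurable_integrable)
  then have "integral_average N S u = integral_average M (\<iota> -` S) (u \<circ> \<iota>)"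
    unfolding integral_average_def set_lebesgue_integral_def
    by (simp add: integral_N emeasure_N[OF S] measure_def indicator_def)
  moreover have "(\<lambda>y. ennreal_powr (e2ennreal \<bar>u y - ereal c\<bar>) q * indicator S y) \<in> borel_measurable N" for c
    using u S \<open>0 < q\<close> by (intro borel_measurable_oscillation) (auto simp: integrable_ereal_on_def)
  ultimately show ?thesis
    unfolding mean_oscillation_def nn_average_def
    by (simp add: nn_integral_N emeasure_N[OF S] indicator_def)
qed

lemma gradient_mean_N:
  assumes "g \<in> borel_measurable (restrict_space borel T)" "T \<in> sets N" "0 < p"
  shows "gradient_mean N p T g = gradient_mean M p (\<iota> -` T) (g \<circ> \<iota>)"
proof -
  have "(\<lambda>y. ennreal_powr (g y) p) \<in> borel_measurable (restrict_space N T)"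
    using assms by (intro borel_measurable_ennreal_powr borel_measurable_restrict_N)
  then have "(\<lambda>y. ennreal_powr (g y) p * indicator T y) \<in> borel_measurable N"
    using assms(2) by (subst (asm) borel_measurable_restrict_space_iff_ennreal) simp_all
  then show ?thesis
    unfolding gradient_mean_def nn_average_def
    by (simp add: nn_integral_N emeasure_N[OF assms(2)] indicator_def)
qed

section \<open>Traces on X of balls in the completion\<close>

lemma emeasure_ball_N:
  assumes "0 < r"
  shows "0 < emeasure M (\<iota> -` ball z r)" "emeasure M (\<iota> -` ball z r) < \<infinity>"
proof -
  have sets: "\<iota> -` ball z r \<in> sets M" using ball_in_sets_N[of z r] by (simp add: sets_N)
  have bsets: "ball x s \<in> sets M" for x s using borel_subset_sets by auto
  \<comment> \<open>The centre \<open>z\<close> may lie outside X. A point of X within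
    \<open>r / 2\<close> of it places the trace of the ball between two balls of X:
    \<open>r / 2 + r / 2 = r\<close> gives the inner inclusion and \<open>r / 2 + r < 2 * r\<close>
    the outer one.\<close>
  obtain x where x: "dist (\<iota> x) z < r / 2" using embedding_dense[of "r / 2" z] assms by auto
  have "ball x (r / 2) \<subseteq> \<iota> -` ball z r"
  proof
    fix y assume "y \<in> ball x (r / 2)"
    then show "y \<in> \<iota> -` ball z r"
      using x dist_triangle[of z "\<iota> y" "\<iota> x"] by (simp add: dist_commute)
  qed
  then have "emeasure M (ball x (r / 2)) \<le> emeasure M (\<iota> -` ball z r)"
    using sets by (rule emeasure_mono)
  then show "0 < emeasure M (\<iota> -` ball z r)"
    using emeasure_ball_pos[of "r / 2" x] assms by (auto intro: less_le_trans)
  have "\<iota> -` ball z r \<subseteq> ball x (2 * r)"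
  proof
    fix y assume "y \<in> \<iota> -` ball z r"
    then show "y \<in> ball x (2 * r)"
      using x assms dist_triangle[of "\<iota> x" "\<iota> y" z] by simp
  qed
  then have "emeasure M (\<iota> -` ball z r) \<le> emeasure M (ball x (2 * r))"
    using bsets by (rule emeasure_mono)
  then show "emeasure M (\<iota> -` ball z r) < \<infinity>"
    using emeasure_ball_finite[of "2 * r" x] assms by (auto intro: le_less_trans)
qed

text \<open>The assumption \<open>sub\<close> makes every approximating ball of X admissible for the
  inequality within \<open>ball x\<^sub>0 R\<close>. The constants \<open>C\<close> and
  \<open>lam\<close> obtained there serve for the completion unchanged.\<close>

lemma poincare_within_completion:
  assumes sub: "\<And>y. \<iota> y \<in> ball z\<^sub>0 r\<^sub>0 \<Longrightarrow> y \<in> ball x\<^sub>0 R"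
    and "poincare_within M q p x\<^sub>0 R" and pq: "0 < p" "0 < q"
  shows "poincare_within N q p z\<^sub>0 r\<^sub>0"
proof -
  obtain C lam where C: "0 < C" and lam: "1 \<le> lam"
    and P: "\<And>x r u g. 0 < r \<Longrightarrow> ball x r \<subseteq> ball x\<^sub>0 R \<Longrightarrow> integrable_ereal_on M (ball x (lam * r)) u \<Longrightarrow>
      upper_gradient_on (ball x (lam * r)) u g \<Longrightarrow>
      mean_oscillation M q (ball x r) u \<le> ennreal (C * r) * gradient_mean M p (ball x (lam * r)) g"
    using assms(2) unfolding poincare_within_iff by auto
  have "mean_oscillation N q (ball z r) u \<le> ennreal (C * r) * gradient_mean N p (ball z (lam * r)) g"
    if r: "0 < r" and zr: "ball z r \<subseteq> ball z\<^sub>0 r\<^sub>0" and u: "integrable_ereal_on N (ball z (lam * r)) u"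
      and g: "upper_gradient_on (ball z (lam * r)) u g" for z r u g
  proof -
    \<comment> \<open>\<open>e n\<close> bounds the displacement of the centre and is also the
      amount by which the radius shrinks. The offset 2 gives \<open>e n < r\<close> already for
      \<open>n = 0\<close>, so all radii \<open>r - e n\<close> are positive.\<close>
    define e where "e n = r / (real n + 2)" for n
    have e: "0 < e n" "e n < r" for n using r by (auto simp: e_def field_simps intro!: add_pos_nonneg)
    have e_lim: "e \<longlonglongrightarrow> 0" using LIMSEQ_ignore_initial_segment[OF lim_const_over_n[of r], of 2]
      by (simp add: e_def[abs_def] add.commute)
    have "\<exists>x. dist (\<iota> x) z < e n" for n using embedding_dense[OF e(1)] by metis
    then obtain x where x: "\<And>n. dist (\<iota> (x n)) z < e n" by metis
    \<comment> \<open>Needed for \<open>k = 1\<close> and \<open>k = lam\<close>. The radius shrinks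
      by \<open>k * e n\<close>, which absorbs the displacement of the centre exactly because
      \<open>1 \<le> k\<close>.\<close>
    have inner: "ball (x n) (k * (r - e n)) \<subseteq> \<iota> -` ball z (k * r)" if "1 \<le> k" for k n
    proof
      fix y assume "y \<in> ball (x n) (k * (r - e n))"
      moreover have "dist z (\<iota> y) \<le> dist (\<iota> (x n)) z + dist (x n) y"
        using dist_triangle[of z "\<iota> y" "\<iota> (x n)"] by (simp add: dist_commute)
      moreover have "e n \<le> k * e n" using mult_right_mono[OF that, of "e n"] e(1)[of n] by simp
      ultimately show "y \<in> \<iota> -` ball z (k * r)" using x[of n] by (simp add: algebra_simps)
    qed
    \<comment> \<open>The strict inequality \<open>dist z (\<iota> y) < k * r\<close> leaves room
      for displacement and shrinking once \<open>e n\<close> is small.\<close>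
    have ev: "eventually (\<lambda>n. y \<in> ball (x n) (k * (r - e n))) sequentially"
      if "y \<in> \<iota> -` ball z (k * r)" for k y
    proof -
      have "(\<lambda>n. e n + dist z (\<iota> y) - k * (r - e n)) \<longlonglongrightarrow> 0 + dist z (\<iota> y) - k * (r - 0)"
        by (intro tendsto_intros e_lim)
      then have "eventually (\<lambda>n. e n + dist z (\<iota> y) - k * (r - e n) < 0) sequentially"
        using that by (intro order_tendstoD(2)) auto
      then show ?thesis
      proof eventually_elim
        case (elim n)
        then show ?case
          using x[of n] dist_triangle[of "\<iota> (x n)" "\<iota> y" z] by simp
      qed
    qed
    have sub_lam: "ball z r \<subseteq> ball z (lam * r)"
      using mult_right_mono[OF lam, of r] r by (intro subset_ball) simp
    have uM: "integrable_ereal_on M (\<iota> -` ball z (lam * r)) (u \<circ> \<iota>)"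
      using u by (rule integrable_ereal_on_N) (rule ball_in_sets_N)
    have bsets: "ball y s \<in> sets M" "\<iota> -` ball z s \<in> sets M" for y s
      using borel_subset_sets ball_in_sets_N[of z s] by (auto simp: sets_N)
    have "mean_oscillation M q (\<iota> -` ball z r) (u \<circ> \<iota>)
        \<le> ennreal (C * r) * gradient_mean M p (\<iota> -` ball z (lam * r)) (g \<circ> \<iota>)"
    proof (rule poincare_inequality_exhaustion[where B = "\<lambda>n. ball (x n) (r - e n)"
          and D = "\<lambda>n. ball (x n) (lam * (r - e n))"])
      show "ball (x n) (r - e n) \<subseteq> \<iota> -` ball z r" for n using inner[of 1 n] by simp
      show "eventually (\<lambda>n. y \<in> ball (x n) (r - e n)) sequentially" if "y \<in> \<iota> -` ball z r" for y
        using ev[of y 1] that by simp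
      show "mean_oscillation M q (ball (x n) (r - e n)) (u \<circ> \<iota>)
        \<le> ennreal (C * r) * gradient_mean M p (ball (x n) (lam * (r - e n))) (g \<circ> \<iota>)" for n
      proof -
        have "mean_oscillation M q (ball (x n) (r - e n)) (u \<circ> \<iota>)
          \<le> ennreal (C * (r - e n)) * gradient_mean M p (ball (x n) (lam * (r - e n))) (g \<circ> \<iota>)"
        proof (rule P)
          show "0 < r - e n" using e(2)[of n] by simp
          show "ball (x n) (r - e n) \<subseteq> ball x\<^sub>0 R"
            using inner[of 1 n] zr sub by auto
          show "integrable_ereal_on M (ball (x n) (lam * (r - e n))) (u \<circ> \<iota>)"
            using uM inner[OF lam] by (rule integrable_ereal_on_subset)
          show "upper_gradient_on (ball (x n) (lam * (r - e n))) (u \<circ> \<iota>) (g \<circ> \<iota>)"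
            using \<iota> g inner[OF lam, of n] by (intro upper_gradient_on_completion) auto
        qed
        \<comment> \<open>The radius \<open>r - e n\<close> is enlarged to \<open>r\<close> so that
          the constant passed to the limit is independent of \<open>n\<close>.\<close>
        also have "\<dots> \<le> ennreal (C * r) * gradient_mean M p (ball (x n) (lam * (r - e n))) (g \<circ> \<iota>)"
          using C e(1)[of n] by (intro mult_right_mono ennreal_leI mult_left_mono) auto
        finally show ?thesis .
      qed
      show "0 < emeasure M (\<iota> -` ball z r)" using r by (rule emeasure_ball_N)
      show "emeasure M (\<iota> -` ball z (lam * r)) < \<infinity>" using r lam by (intro emeasure_ball_N) simp
      show "\<iota> -` ball z r \<subseteq> \<iota> -` ball z (lam * r)" using sub_lam by (rule vimage_mono)
    qed (fact bsets inner[OF lam] ev uM pq)+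
    moreover have "mean_oscillation N q (ball z r) u = mean_oscillation M q (\<iota> -` ball z r) (u \<circ> \<iota>)"
      using integrable_ereal_on_subset[OF u sub_lam] ball_in_sets_N pq(2) by (rule mean_oscillation_N)
    moreover have "gradient_mean N p (ball z (lam * r)) g
        = gradient_mean M p (\<iota> -` ball z (lam * r)) (g \<circ> \<iota>)"
      using g ball_in_sets_N pq(1) by (intro gradient_mean_N) (auto simp: upper_gradient_on_def)
    ultimately show ?thesis by simp
  qed
  then show ?thesis
    using C lam unfolding poincare_within_iff
    by (intro exI[of _ C] exI[of _ lam] conjI allI impI) auto
qed

end

theorem corollary3p7:
  fixes M :: "'a::metric_space measure"
    and \<iota> :: "'a \<Rightarrow> 'b::complete_space"
    and p q :: real
  assumes "metric_measure_space M"
    and "completion_embedding \<iota>"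
    and "1 < p" and "1 \<le> q"
    and "semilocal_poincare M q p"
  shows "semilocal_poincare (completion_measure \<iota> M) q p"
  unfolding semilocal_poincare_def
proof (intro allI impI)
  fix z\<^sub>0 :: 'b and r\<^sub>0 :: real
  assume r: "0 < r\<^sub>0"
  \<comment> \<open>The centre is moved to a point of X at distance less than
    \<open>r\<^sub>0\<close>; doubling the radius compensates for the move, by the triangle
    inequality.\<close>
  obtain x\<^sub>0 where x: "dist (\<iota> x\<^sub>0) z\<^sub>0 < r\<^sub>0"
    using embedding_dense[OF assms(1,2) r] .
  show "poincare_within (completion_measure \<iota> M) q p z\<^sub>0 r\<^sub>0"
  proof (rule poincare_within_completion[OF assms(1,2)])
    show "poincare_within M q p x\<^sub>0 (2 * r\<^sub>0)"
      using assms(5) r by (simp add: semilocal_poincare_def)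
    show "y \<in> ball x\<^sub>0 (2 * r\<^sub>0)" if "\<iota> y \<in> ball z\<^sub>0 r\<^sub>0" for y
      using that x dist_triangle[of "\<iota> x\<^sub>0" "\<iota> y" z\<^sub>0] dist_embedding[OF assms(1,2), of x\<^sub>0 y] by simp
  qed (use assms in auto)
qed

end
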